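(* The functors $$H:\mathbf{TopDLat}_W^{\mathrm{op}}\to\mathbf{DLat}_W \quad\text{and}\quad K:\mathbf{DLat}_W\to\mathbf{TopDLat}_W^{\mathrm{op}}$$ (defined in the context) are inverse to each other (up to natural isomorphism) and hence yield a duality between the category $\mathbf{TopDLat}_W$ and the category $\mathbf{DLat}_W$.
   Context: All distributive lattices are bounded; sublattices contain $0,1$. $\mathcal O(X)$ is the frame of open sets of a space $X$. For a distributive lattice $D$, $Spec(D)$ is the set of prime ideals of $D$ with the topology with basic open sets $\{P\mid d\notin P\}$ ($d\in D$), and $Max(D)\subseteq Spec(D)$ is the subspace of maximal ideals. A lattice homomorphism $f:D\to D'$ induces $Spec(f)=f^{-1}:Spec(D')\to Spec(D)$; $f$ is called maximal if this restricts to a (continuous) map $Max(f):Max(D')\to Max(D)$. $D$ is conjunctive if for all $a,b\in D$: if every $c\in D$ with $a\vee c=1$ satisfies $b\vee c=1$, then $a\le b$. A Wallman base for a topological space $X$ is a sublattice $B$ of $\mathcal O(X)$ which is a base for the topology and such that for every $U\in B$ and $x\in U$ there is $V\in B$ with $U\cup V=X$ and $x\notin V$. For a sublattice $B\subseteq\mathcal O(X)$, $\eta^X_B:X\to Spec(B)$ is the continuous map $x\mapsto\{b\in B\mid x\notin b\}$. $\mathbf{TopDLat}$: objects are pairs $(X,D)$ with $X$ a topological space and $D$ a sublattice of $\mathcal O(X)$; arrows $(X,D)\to(Y,D')$ are continuous maps $f:X\to Y$ such that $f^{-1}:\mathcal O(Y)\to\mathcal O(X)$ restricts to a map $D'\to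 D$. $\mathbf{TopDLat}_W$ is its full subcategory on the $(X,B)$ such that $X$ is $T_0$, $B$ is a Wallman base for $X$, and $\eta^X_B$ is surjective (equivalently, a homeomorphism) onto $Max(B)$. $\mathbf{DLat}_W$ is the category of conjunctive distributive lattices and maximal homomorphisms. $H$ sends $(X,B)$ to $B$ and $f:(X,B)\to(Y,B')$ to $f^{-1}|:B'\to B$. $K$ sends $D$ to $(Max(D),D)$, where $D$ is identified with its image under the (injective, by conjunctivity) map $D\to\mathcal O(Max(D))$, $d\mapsto\{M\in Max(D)\mid d\notin M\}$, and sends $f:D\to D'$ to $Max(f):Max(D')\to Max(D)$. *)

theory Defs
  imports "HOL-Analysis.Analysis" "HOL-Algebra.Complete_Lattice"
begin

text \<open>
  Lattices are order structures of \<^typ>\<open>'a gorder\<close> with an explicit carrier, spaces are abstract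
  topologies. The objects of a category range over all carrier types: hom sets, identities,
  composition and the object and arrow parts of functors are polymorphic constants, and an arrow
  may connect objects over two different types. This is needed because \<open>K\<close> sends a lattice over
  \<^typ>\<open>'a\<close> to a space of subsets of \<^typ>\<open>'a\<close>.
  Arrows are functions that are \<^const>\<open>undefined\<close> outside the carrier of their source
  (\<^const>\<open>extensional\<close>), so that equality of arrows is equality of functions.
\<close>

section \<open>Distributive lattices and their spectra\<close>

definition bounded_distributive_lattice :: "'a gorder \<Rightarrow> bool" where
  "bounded_distributive_lattice L \<longleftrightarrow> bounded_lattice L \<and>
     (\<forall>x\<in>carrier L. \<forall>y\<in>carrier L. \<forall>z\<in>carrier L.
        x \<sqinter>\<^bsub>L\<^esub> (y \<squnion>\<^bsub>L\<^esub> z) = (x \<sqinter>\<^bsub>L\<^esub> y) \<squnion>\<^bsub>L\<^esub> (x \<sqinter>\<^bsub>L\<^esub> z))"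

definition lattice_ideal :: "'a gorder \<Rightarrow> 'a set \<Rightarrow> bool" where
  "lattice_ideal L I \<longleftrightarrow> I \<subseteq> carrier L \<and> \<bottom>\<^bsub>L\<^esub> \<in> I \<and>
     (\<forall>x\<in>I. \<forall>y\<in>I. x \<squnion>\<^bsub>L\<^esub> y \<in> I) \<and>
     (\<forall>x\<in>I. \<forall>y\<in>carrier L. y \<sqsubseteq>\<^bsub>L\<^esub> x \<longrightarrow> y \<in> I)"

definition prime_ideals :: "'a gorder \<Rightarrow> 'a set set" where
  "prime_ideals L = {P. lattice_ideal L P \<and> P \<noteq> carrier L \<and>
     (\<forall>x\<in>carrier L. \<forall>y\<in>carrier L. x \<sqinter>\<^bsub>L\<^esub> y \<in> P \<longrightarrow> x \<in> P \<or> y \<in> P)}"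

definition maximal_ideals :: "'a gorder \<Rightarrow> 'a set set" where
  "maximal_ideals L = {M. lattice_ideal L M \<and> M \<noteq> carrier L \<and>
     (\<forall>I. lattice_ideal L I \<and> I \<noteq> carrier L \<and> M \<subseteq> I \<longrightarrow> I = M)}"

definition Spec :: "'a gorder \<Rightarrow> 'a set topology" where
  "Spec L = topology_generated_by {{P \<in> prime_ideals L. d \<notin> P} | d. d \<in> carrier L}"

definition Max_spec :: "'a gorder \<Rightarrow> 'a set topology" where
  "Max_spec L = subtopology (Spec L) (maximal_ideals L)"

definition lattice_hom :: "'a gorder \<Rightarrow> 'b gorder \<Rightarrow> ('a \<Rightarrow> 'b) set" where
  "lattice_hom L L' = {f \<in> carrier L \<rightarrow>\<^sub>E carrier L'.
     f \<bottom>\<^bsub>L\<^esub> = \<bottom>\<^bsub>L'\<^esub> \<and> f \<top>\<^bsub>L\<^esub> = \<top>\<^bsub>L'\<^esub> \<and>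
     (\<forall>x\<in>carrier L. \<forall>y\<in>carrier L.
        f (x \<squnion>\<^bsub>L\<^esub> y) = f x \<squnion>\<^bsub>L'\<^esub> f y \<and> f (x \<sqinter>\<^bsub>L\<^esub> y) = f x \<sqinter>\<^bsub>L'\<^esub> f y)}"

definition Spec_map :: "'a gorder \<Rightarrow> ('a \<Rightarrow> 'b) \<Rightarrow> 'b set \<Rightarrow> 'a set" where
  "Spec_map L f P = {d \<in> carrier L. f d \<in> P}"

definition conjunctive :: "'a gorder \<Rightarrow> bool" where
  "conjunctive L \<longleftrightarrow> (\<forall>a\<in>carrier L. \<forall>b\<in>carrier L.
     (\<forall>c\<in>carrier L. a \<squnion>\<^bsub>L\<^esub> c = \<top>\<^bsub>L\<^esub> \<longrightarrow> b \<squnion>\<^bsub>L\<^esub> c = \<top>\<^bsub>L\<^esub>) \<longrightarrow> a \<sqsubseteq>\<^bsub>L\<^esub> b)"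


section \<open>The category of conjunctive distributive lattices and maximal homomorphisms\<close>

definition DLatW_Ob :: "'a gorder set" where
  "DLatW_Ob = {L. bounded_distributive_lattice L \<and> conjunctive L}"

definition DLatW_Hom :: "'a gorder \<Rightarrow> 'b gorder \<Rightarrow> ('a \<Rightarrow> 'b) set" where
  "DLatW_Hom L L' = {f \<in> lattice_hom L L'. Spec_map L f \<in> maximal_ideals L' \<rightarrow> maximal_ideals L}"

definition DLatW_id :: "'a gorder \<Rightarrow> 'a \<Rightarrow> 'a" where
  "DLatW_id L = (\<lambda>x\<in>carrier L. x)"

definition DLatW_comp :: "'a gorder \<Rightarrow> ('b \<Rightarrow> 'c) \<Rightarrow> ('a \<Rightarrow> 'b) \<Rightarrow> 'a \<Rightarrow> 'c" where
  "DLatW_comp L g f = compose (carrier L) g f"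

definition DLatW_iso :: "'a gorder \<Rightarrow> 'b gorder \<Rightarrow> ('a \<Rightarrow> 'b) set" where
  "DLatW_iso L L' = {f \<in> DLatW_Hom L L'. \<exists>g\<in>DLatW_Hom L' L.
     DLatW_comp L g f = DLatW_id L \<and> DLatW_comp L' f g = DLatW_id L'}"


section \<open>The category of spaces with a Wallman base\<close>

type_synonym 'a topdlat = "'a topology \<times> 'a set set"

definition open_sublattice :: "'a topology \<Rightarrow> 'a set set \<Rightarrow> bool" where
  "open_sublattice X D \<longleftrightarrow> (\<forall>U\<in>D. openin X U) \<and> {} \<in> D \<and> topspace X \<in> D \<and>
     (\<forall>U\<in>D. \<forall>V\<in>D. U \<union> V \<in> D \<and> U \<inter> V \<in> D)"

definition set_lattice :: "'a set set \<Rightarrow> 'a set gorder" where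
  "set_lattice D = \<lparr>carrier = D, eq = (=), le = (\<subseteq>)\<rparr>"

definition Wallman_base :: "'a topology \<Rightarrow> 'a set set \<Rightarrow> bool" where
  "Wallman_base X B \<longleftrightarrow> open_sublattice X B \<and>
     openin X = arbitrary union_of (\<lambda>U. U \<in> B) \<and>
     (\<forall>U\<in>B. \<forall>x\<in>U. \<exists>V\<in>B. U \<union> V = topspace X \<and> x \<notin> V)"

definition eta :: "'a topdlat \<Rightarrow> 'a \<Rightarrow> 'a set set" where
  "eta A = (case A of (X, B) \<Rightarrow> (\<lambda>x\<in>topspace X. {b \<in> B. x \<notin> b}))"

definition TopDLatW_Ob :: "'a topdlat set" where
  "TopDLatW_Ob = {(X, B). t0_space X \<and> Wallman_base X B \<and>
     eta (X, B) ` topspace X = maximal_ideals (set_lattice B)}"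

definition preim :: "'a topology \<Rightarrow> ('a \<Rightarrow> 'b) \<Rightarrow> 'b set \<Rightarrow> 'a set" where
  "preim X f V = {x \<in> topspace X. f x \<in> V}"

definition TopDLatW_Hom :: "'a topdlat \<Rightarrow> 'b topdlat \<Rightarrow> ('a \<Rightarrow> 'b) set" where
  "TopDLatW_Hom A A' = (case (A, A') of ((X, D), (Y, D')) \<Rightarrow>
     {f \<in> extensional (topspace X). continuous_map X Y f \<and> preim X f \<in> D' \<rightarrow> D})"

definition TopDLatW_id :: "'a topdlat \<Rightarrow> 'a \<Rightarrow> 'a" where
  "TopDLatW_id A = (\<lambda>x\<in>topspace (fst A). x)"

definition TopDLatW_comp :: "'a topdlat \<Rightarrow> ('b \<Rightarrow> 'c) \<Rightarrow> ('a \<Rightarrow> 'b) \<Rightarrow> 'a \<Rightarrow> 'c" where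
  "TopDLatW_comp A g f = compose (topspace (fst A)) g f"

definition TopDLatW_iso :: "'a topdlat \<Rightarrow> 'b topdlat \<Rightarrow> ('a \<Rightarrow> 'b) set" where
  "TopDLatW_iso A A' = {f \<in> TopDLatW_Hom A A'. \<exists>g\<in>TopDLatW_Hom A' A.
     TopDLatW_comp A g f = TopDLatW_id A \<and> TopDLatW_comp A' f g = TopDLatW_id A'}"


section \<open>The contravariant functors \<open>H\<close> and \<open>K\<close>\<close>

definition H_ob :: "'a topdlat \<Rightarrow> 'a set gorder" where
  "H_ob A = set_lattice (snd A)"

text \<open>For \<open>f\<close> from \<open>A\<close> to \<open>A'\<close>, the arrow \<open>H_arr A A' f\<close> goes from \<open>H_ob A'\<close> to \<open>H_ob A\<close>; similarly
  for \<open>K_arr\<close>.\<close>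

definition H_arr :: "'a topdlat \<Rightarrow> 'b topdlat \<Rightarrow> ('a \<Rightarrow> 'b) \<Rightarrow> 'b set \<Rightarrow> 'a set" where
  "H_arr A A' f = (\<lambda>V\<in>snd A'. preim (fst A) f V)"

definition basic_Max :: "'a gorder \<Rightarrow> 'a \<Rightarrow> 'a set set" where
  "basic_Max L = (\<lambda>d\<in>carrier L. {M \<in> maximal_ideals L. d \<notin> M})"

definition K_ob :: "'a gorder \<Rightarrow> 'a set topdlat" where
  "K_ob L = (Max_spec L, basic_Max L ` carrier L)"

definition K_arr :: "'a gorder \<Rightarrow> 'b gorder \<Rightarrow> ('a \<Rightarrow> 'b) \<Rightarrow> 'b set \<Rightarrow> 'a set" where
  "K_arr L L' f = (\<lambda>M\<in>maximal_ideals L'. Spec_map L f M)"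


section \<open>Category laws\<close>

lemma DLatW_id_Hom: "DLatW_id L \<in> DLatW_Hom L L" if "L \<in> DLatW_Ob"
proof -
  interpret bounded_lattice L
    using that by (simp add: DLatW_Ob_def bounded_distributive_lattice_def)
  have "Spec_map L (DLatW_id L) M = M" if "M \<in> maximal_ideals L" for M
    using that by (auto simp: Spec_map_def DLatW_id_def maximal_ideals_def lattice_ideal_def)
  then show ?thesis
    by (auto simp: DLatW_Hom_def lattice_hom_def DLatW_id_def)
qed

lemma DLatW_comp_Hom:
  assumes "L \<in> DLatW_Ob" "f \<in> DLatW_Hom L L'" "g \<in> DLatW_Hom L' L''"
  shows "DLatW_comp L g f \<in> DLatW_Hom L L''"
proof -
  interpret bounded_lattice L
    using assms(1) by (simp add: DLatW_Ob_def bounded_distributive_lattice_def)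
  have f: "f \<in> carrier L \<rightarrow>\<^sub>E carrier L'" and g: "g \<in> carrier L' \<rightarrow>\<^sub>E carrier L''"
    using assms by (auto simp: DLatW_Hom_def lattice_hom_def)
  have fx: "f x \<in> carrier L'" if "x \<in> carrier L" for x
    using f that by blast
  have "DLatW_comp L g f \<in> carrier L \<rightarrow>\<^sub>E carrier L''"
    using f g by (auto simp: DLatW_comp_def compose_def)
  moreover have "Spec_map L (DLatW_comp L g f) M = Spec_map L f (Spec_map L' g M)" for M
    by (auto simp: Spec_map_def DLatW_comp_def compose_def fx)
  ultimately show ?thesis
    using assms(2,3) by (auto simp: DLatW_Hom_def lattice_hom_def DLatW_comp_def compose_def fx)
qed

lemma DLatW_comp_id:
  assumes "f \<in> DLatW_Hom L L'"
  shows "DLatW_comp L f (DLatW_id L) = f" "DLatW_comp L (DLatW_id L') f = f"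
  using assms unfolding DLatW_Hom_def lattice_hom_def DLatW_comp_def DLatW_id_def
  by (auto intro!: compose_Id Id_compose simp: PiE_iff)

lemma DLatW_comp_assoc:
  assumes "f \<in> DLatW_Hom L L'"
  shows "DLatW_comp L h (DLatW_comp L g f) = DLatW_comp L (DLatW_comp L' h g) f"
  using assms unfolding DLatW_Hom_def lattice_hom_def DLatW_comp_def
  by (auto intro!: compose_assoc)

lemma TopDLatW_id_Hom: "TopDLatW_id A \<in> TopDLatW_Hom A A" if "A \<in> TopDLatW_Ob"
proof -
  obtain X B where A: "A = (X, B)" by fastforce
  have "preim X (\<lambda>x\<in>topspace X. x) U = U" if "U \<in> B" for U
    using that \<open>A \<in> TopDLatW_Ob\<close> openin_subset
    by (fastforce simp: A preim_def TopDLatW_Ob_def Wallman_base_def open_sublattice_def)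
  moreover have "continuous_map X X (\<lambda>x\<in>topspace X. x)"
    by (rule continuous_map_eq[OF continuous_map_id]) auto
  ultimately show ?thesis
    by (auto simp: A TopDLatW_Hom_def TopDLatW_id_def)
qed

lemma TopDLatW_comp_Hom:
  assumes "f \<in> TopDLatW_Hom A A'" "g \<in> TopDLatW_Hom A' A''"
  shows "TopDLatW_comp A g f \<in> TopDLatW_Hom A A''"
proof -
  obtain X D Y D' Z D'' where A: "A = (X, D)" "A' = (Y, D')" "A'' = (Z, D'')"
    by (metis surj_pair)
  have f: "continuous_map X Y f" and g: "continuous_map Y Z g"
    using assms by (auto simp: A TopDLatW_Hom_def)
  have "continuous_map X Z (compose (topspace X) g f)"
    by (rule continuous_map_eq[OF continuous_map_compose[OF f g]]) (simp add: compose_def)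
  moreover have "preim X (compose (topspace X) g f) W = preim X f (preim Y g W)" for W
    using continuous_map_funspace[OF f] by (auto simp: preim_def compose_def)
  ultimately show ?thesis
    using assms by (auto simp: A TopDLatW_Hom_def TopDLatW_comp_def)
qed

lemma TopDLatW_comp_id:
  assumes "f \<in> TopDLatW_Hom A A'"
  shows "TopDLatW_comp A f (TopDLatW_id A) = f" "TopDLatW_comp A (TopDLatW_id A') f = f"
proof -
  obtain X D Y D' where A: "A = (X, D)" "A' = (Y, D')"
    by (metis surj_pair)
  have "f \<in> topspace X \<rightarrow> topspace Y" "f \<in> extensional (topspace X)"
    using assms continuous_map_funspace by (auto simp: A TopDLatW_Hom_def)
  then show "TopDLatW_comp A f (TopDLatW_id A) = f" "TopDLatW_comp A (TopDLatW_id A') f = f"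
    by (simp_all add: A TopDLatW_comp_def TopDLatW_id_def compose_Id Id_compose)
qed

lemma TopDLatW_comp_assoc:
  assumes "f \<in> TopDLatW_Hom A A'"
  shows "TopDLatW_comp A h (TopDLatW_comp A g f) = TopDLatW_comp A (TopDLatW_comp A' h g) f"
proof -
  have "f \<in> topspace (fst A) \<rightarrow> topspace (fst A')"
    using assms by (auto simp: TopDLatW_Hom_def continuous_map_def split: prod.splits)
  then show ?thesis
    by (simp add: TopDLatW_comp_def compose_assoc)
qed

end

theory Submission
  imports Defs
begin

text \<open>
  A maximal ideal omitting \<open>d\<close> contains some \<open>c\<close> with \<open>d \<squnion> c = \<top>\<close>. This one fact makes maximal ideals
  of a distributive lattice prime and the sets \<open>{M. d \<notin> M}\<close> a Wallman base of the maximal spectrum;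
  conjunctivity, through Zorn's lemma, says exactly that distinct elements give distinct such sets,
  so that \<open>basic_Max\<close> is an isomorphism. Conversely, the Wallman condition turns
  into conjunctivity of the base. A preimage map \<open>f\<^sup>-\<^sup>1\<close> is a maximal homomorphism because it pulls
  \<open>eta x\<close> back to \<open>eta (f x)\<close> and every maximal ideal of the base has the form \<open>eta x\<close>.
\<close>

section \<open>Ideals of bounded lattices\<close>

lemma lattice_hom_closed: "f \<in> lattice_hom L L' \<Longrightarrow> x \<in> carrier L \<Longrightarrow> f x \<in> carrier L'"
  by (auto simp: lattice_hom_def)

lemma lattice_hom_mono:
  assumes "bounded_lattice L" "bounded_lattice L'" "f \<in> lattice_hom L L'"
    and "x \<in> carrier L" "y \<in> carrier L" "x \<sqsubseteq>\<^bsub>L\<^esub> y"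
  shows "f x \<sqsubseteq>\<^bsub>L'\<^esub> f y"
proof -
  interpret L: bounded_lattice L by fact
  interpret L': bounded_lattice L' by fact
  have "f x \<squnion>\<^bsub>L'\<^esub> f y = f (x \<squnion>\<^bsub>L\<^esub> y)"
    using assms by (simp add: lattice_hom_def)
  \<comment> \<open>Despite its name, \<open>le_iff_meet\<close> characterises the order by joins:
    \<open>x\<close> is below \<open>y\<close> iff their join is \<open>y\<close>.\<close>
  also have "\<dots> = f y"
    using assms by (simp add: L.le_iff_meet)
  finally show ?thesis
    using assms by (simp add: L'.le_iff_meet lattice_hom_closed)
qed

text \<open>Downward closure spreads the top element over the whole carrier. Properness thus becomes
  a condition on a single element, a form that passes to unions of chains.\<close>

lemma lattice_ideal_top:
  assumes "bounded_lattice L" "lattice_ideal L I"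
  shows "I \<noteq> carrier L \<longleftrightarrow> \<top>\<^bsub>L\<^esub> \<notin> I"
proof -
  interpret bounded_lattice L by fact
  show ?thesis
    using assms(2) by (auto simp: lattice_ideal_def)
qed

lemma lattice_ideal_Spec_map:
  assumes "bounded_lattice L" "bounded_lattice L'" "f \<in> lattice_hom L L'" "lattice_ideal L' I"
  shows "lattice_ideal L (Spec_map L f I)"
proof -
  interpret bounded_lattice L by fact
  note [simp] = lattice_hom_closed[OF assms(3)]
  have "f y \<in> I" if "f x \<in> I" "x \<in> carrier L" "y \<in> carrier L" "y \<sqsubseteq>\<^bsub>L\<^esub> x" for x y
    using that lattice_hom_mono[OF assms(1-3), of y x] assms(4) by (simp add: lattice_ideal_def)
  then show ?thesis
    using assms(3,4) by (auto simp: lattice_ideal_def Spec_map_def lattice_hom_def)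
qed

lemma proper_Spec_map:
  assumes "bounded_lattice L" "bounded_lattice L'" "f \<in> lattice_hom L L'"
    and "lattice_ideal L' I" "I \<noteq> carrier L'"
  shows "Spec_map L f I \<noteq> carrier L"
proof -
  interpret bounded_lattice L by fact
  have "\<top>\<^bsub>L\<^esub> \<notin> Spec_map L f I"
    using assms lattice_ideal_top by (auto simp: Spec_map_def lattice_hom_def)
  then show ?thesis by auto
qed

text \<open>Pulling back along \<open>g\<close> and then along \<open>f\<close> is pulling back
  along the composite of \<open>f\<close> followed by \<open>g\<close>, which is the identity on the
  carrier.\<close>

lemma Spec_map_inverse:
  assumes "f \<in> lattice_hom L L'" "\<And>x. x \<in> carrier L \<Longrightarrow> g (f x) = x" "I \<subseteq> carrier L"
  shows "Spec_map L f (Spec_map L' g I) = I"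
  using assms lattice_hom_closed[OF assms(1)] by (auto simp: Spec_map_def)

text \<open>A proper ideal \<open>I\<close> above the pullback of \<open>M\<close> is carried by
  \<open>g\<close> to a proper ideal above \<open>M\<close>, hence to \<open>M\<close> itself;
  pulling back along \<open>f\<close> recovers \<open>I\<close>. General homomorphisms need not pull
  maximal ideals back to maximal ideals, so isomorphisms of lattices need this argument to become
  arrows.\<close>

lemma Spec_map_iso_maximal:
  assumes "bounded_lattice L" "bounded_lattice L'" "f \<in> lattice_hom L L'" "g \<in> lattice_hom L' L"
    and gf: "\<And>x. x \<in> carrier L \<Longrightarrow> g (f x) = x" and fg: "\<And>y. y \<in> carrier L' \<Longrightarrow> f (g y) = y"
    and M: "M \<in> maximal_ideals L'"
  shows "Spec_map L f M \<in> maximal_ideals L"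
proof -
  have M': "lattice_ideal L' M" "M \<noteq> carrier L'" "M \<subseteq> carrier L'"
    using M by (auto simp: maximal_ideals_def lattice_ideal_def)
  have "I = Spec_map L f M"
    if I: "lattice_ideal L I" "I \<noteq> carrier L" "Spec_map L f M \<subseteq> I" for I
  proof -
    have "M = Spec_map L' g (Spec_map L f M)"
      using Spec_map_inverse[OF assms(4) fg] M' by auto
    also have "\<dots> \<subseteq> Spec_map L' g I"
      using I by (auto simp: Spec_map_def)
    finally have "Spec_map L' g I = M"
      using M I lattice_ideal_Spec_map[OF assms(2,1,4) I(1)] proper_Spec_map[OF assms(2,1,4) I(1,2)]
      by (auto simp: maximal_ideals_def)
    moreover have "I \<subseteq> carrier L"
      using I by (simp add: lattice_ideal_def)
    ultimately show ?thesis
      using Spec_map_inverse[OF assms(3) gf] by metis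
  qed
  then show ?thesis
    using lattice_ideal_Spec_map[OF assms(1-3) M'(1)] proper_Spec_map[OF assms(1-3) M'(1,2)]
    by (auto simp: maximal_ideals_def)
qed

text \<open>Every element of \<open>carrier L'\<close> is some \<open>f u\<close>, so the operations
  of \<open>L'\<close> are computed in \<open>L\<close> and carried over by \<open>f\<close>; the
  inverse undoes this. The \<open>restrict\<close> makes it extensional, as arrows are.\<close>

lemma lattice_hom_inverse:
  assumes "bounded_lattice L" "f \<in> lattice_hom L L'" "inj_on f (carrier L)"
    and "f ` carrier L = carrier L'"
  shows "restrict (inv_into (carrier L) f) (carrier L') \<in> lattice_hom L' L" (is "?g \<in> _")
proof -
  interpret bounded_lattice L by fact
  have gf: "?g (f x) = x" if "x \<in> carrier L" for x
    using that assms by auto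
  have f: "f \<bottom>\<^bsub>L\<^esub> = \<bottom>\<^bsub>L'\<^esub>" "f \<top>\<^bsub>L\<^esub> = \<top>\<^bsub>L'\<^esub>"
    "\<And>x y. x \<in> carrier L \<Longrightarrow> y \<in> carrier L \<Longrightarrow> f x \<squnion>\<^bsub>L'\<^esub> f y = f (x \<squnion>\<^bsub>L\<^esub> y)"
    "\<And>x y. x \<in> carrier L \<Longrightarrow> y \<in> carrier L \<Longrightarrow> f x \<sqinter>\<^bsub>L'\<^esub> f y = f (x \<sqinter>\<^bsub>L\<^esub> y)"
    using assms(2) by (auto simp: lattice_hom_def)
  have "?g \<in> carrier L' \<rightarrow>\<^sub>E carrier L"
    using assms(4) by (auto simp: inv_into_into)
  moreover have "?g \<bottom>\<^bsub>L'\<^esub> = \<bottom>\<^bsub>L\<^esub>" "?g \<top>\<^bsub>L'\<^esub> = \<top>\<^bsub>L\<^esub>"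
    using gf[of "\<bottom>\<^bsub>L\<^esub>"] gf[of "\<top>\<^bsub>L\<^esub>"] f by simp_all
  moreover have "?g (y \<squnion>\<^bsub>L'\<^esub> z) = ?g y \<squnion>\<^bsub>L\<^esub> ?g z \<and> ?g (y \<sqinter>\<^bsub>L'\<^esub> z) = ?g y \<sqinter>\<^bsub>L\<^esub> ?g z"
    if yz: "y \<in> carrier L'" "z \<in> carrier L'" for y z
  proof -
    obtain u v where uv: "y = f u" "z = f v" "u \<in> carrier L" "v \<in> carrier L"
      using yz unfolding assms(4)[symmetric] by blast
    show ?thesis
      unfolding uv(1,2) f(3,4)[OF uv(3,4)] gf[OF uv(3)] gf[OF uv(4)]
        gf[OF join_closed[OF uv(3,4)]] gf[OF meet_closed[OF uv(3,4)]] by simp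
  qed
  ultimately show ?thesis
    unfolding lattice_hom_def by blast
qed


section \<open>Maximal ideals of distributive lattices\<close>

text \<open>The predicate \<open>bounded_distributive_lattice\<close> recast as a locale, so that
  the theory of \<open>bounded_lattice\<close> is available in its context.\<close>

locale bounded_distrib_lattice = bounded_lattice L for L :: "'a gorder" (structure) +
  assumes distrib: "\<lbrakk>x \<in> carrier L; y \<in> carrier L; z \<in> carrier L\<rbrakk>
    \<Longrightarrow> x \<sqinter> (y \<squnion> z) = (x \<sqinter> y) \<squnion> (x \<sqinter> z)"
begin

lemma maximal_idealD:
  assumes "M \<in> maximal_ideals L"
  shows "lattice_ideal L M" "M \<noteq> carrier L" "M \<subseteq> carrier L" "\<bottom> \<in> M" "\<top> \<notin> M"
    and "\<And>x y. x \<in> M \<Longrightarrow> y \<in> M \<Longrightarrow> x \<squnion> y \<in> M"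
    and "\<And>x y. x \<in> M \<Longrightarrow> y \<in> carrier L \<Longrightarrow> y \<sqsubseteq> x \<Longrightarrow> y \<in> M"
proof -
  show M: "lattice_ideal L M" "M \<noteq> carrier L"
    using assms by (auto simp: maximal_ideals_def)
  show "\<top> \<notin> M"
    using lattice_ideal_top[OF bounded_lattice_axioms M(1)] M(2) by blast
  show "M \<subseteq> carrier L" "\<bottom> \<in> M" "\<And>x y. x \<in> M \<Longrightarrow> y \<in> M \<Longrightarrow> x \<squnion> y \<in> M"
    "\<And>x y. x \<in> M \<Longrightarrow> y \<in> carrier L \<Longrightarrow> y \<sqsubseteq> x \<Longrightarrow> y \<in> M"
    using M(1) by (auto simp: lattice_ideal_def)
qed

lemma maximal_ideals_eqI:
  assumes "M \<in> maximal_ideals L" "N \<in> maximal_ideals L" "M \<subseteq> N"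
  shows "M = N"
  using assms maximal_idealD(1,2)[OF assms(2)] by (auto simp: maximal_ideals_def)

text \<open>The set is the ideal generated by \<open>I\<close> and \<open>d\<close>. If
  \<open>b\<close> and \<open>c\<close> witness membership of \<open>x\<close> and \<open>y\<close>,
  then \<open>b \<squnion> c\<close> witnesses that of \<open>x \<squnion> y\<close>.\<close>

lemma lattice_ideal_insert:
  assumes I: "lattice_ideal L I" and d: "d \<in> carrier L"
  shows "lattice_ideal L {x \<in> carrier L. \<exists>c\<in>I. x \<sqsubseteq> d \<squnion> c}" (is "lattice_ideal L ?J")
proof -
  have IL: "I \<subseteq> carrier L" "\<bottom> \<in> I" "\<And>x y. x \<in> I \<Longrightarrow> y \<in> I \<Longrightarrow> x \<squnion> y \<in> I"
    using I by (auto simp: lattice_ideal_def)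
  have "x \<squnion> y \<in> ?J" if xy: "x \<in> ?J" "y \<in> ?J" for x y
  proof -
    obtain b c where bc: "b \<in> I" "c \<in> I" "x \<sqsubseteq> d \<squnion> b" "y \<sqsubseteq> d \<squnion> c"
      using xy by blast
    have carr: "x \<in> carrier L" "y \<in> carrier L" "b \<in> carrier L" "c \<in> carrier L"
      using xy bc IL(1) by auto
    let ?u = "d \<squnion> (b \<squnion> c)"
    have u: "b \<squnion> c \<in> carrier L" "?u \<in> carrier L"
      using carr d by simp_all
    have le: "d \<sqsubseteq> ?u" "b \<squnion> c \<sqsubseteq> ?u"
      using join_left[OF d u(1)] join_right[OF d u(1)] by simp_all
    have "b \<sqsubseteq> ?u" "c \<sqsubseteq> ?u"
      using le_trans[OF join_left[OF carr(3,4)] le(2)] le_trans[OF join_right[OF carr(3,4)] le(2)]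
        carr u by simp_all
    then have "d \<squnion> b \<sqsubseteq> ?u" "d \<squnion> c \<sqsubseteq> ?u"
      using join_le le(1) carr d u by simp_all
    then have "x \<sqsubseteq> ?u" "y \<sqsubseteq> ?u"
      using le_trans[OF bc(3)] le_trans[OF bc(4)] carr d u by simp_all
    then have "x \<squnion> y \<sqsubseteq> ?u"
      using join_le carr u by simp
    then show ?thesis
      using carr u bc IL by auto
  qed
  moreover have "y \<in> ?J" if "x \<in> ?J" "y \<in> carrier L" "y \<sqsubseteq> x" for x y
  proof -
    obtain c where "x \<in> carrier L" "c \<in> I" "x \<sqsubseteq> d \<squnion> c"
      using \<open>x \<in> ?J\<close> by blast
    then have "y \<sqsubseteq> d \<squnion> c"
      using that(2,3) IL(1) d by (meson join_closed le_trans subsetD)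
    then show ?thesis
      using \<open>c \<in> I\<close> that(2) by blast
  qed
  moreover have "\<bottom> \<in> ?J"
    using IL(1,2) d by (auto intro!: bexI[of _ \<bottom>])
  moreover have "?J \<subseteq> carrier L"
    by blast
  ultimately show ?thesis
    unfolding lattice_ideal_def by (intro conjI ballI impI)
qed

text \<open>The ideal generated by \<open>M\<close> and \<open>d\<close> properly extends
  \<open>M\<close>, so by maximality it is everything. The element \<open>c\<close> is what puts the
  top into it.\<close>

lemma maximal_ideal_witness:
  assumes M: "M \<in> maximal_ideals L" and d: "d \<in> carrier L" "d \<notin> M"
  obtains c where "c \<in> M" "d \<squnion> c = \<top>"
proof -
  let ?J = "{x \<in> carrier L. \<exists>c\<in>M. x \<sqsubseteq> d \<squnion> c}"
  note MD = maximal_idealD[OF M]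
  have "lattice_ideal L ?J"
    by (rule lattice_ideal_insert[OF MD(1) d(1)])
  moreover have "d \<in> ?J" "M \<subseteq> ?J"
    using d MD(3,4) join_left join_right by blast+
  ultimately have "?J = carrier L"
    using M d unfolding maximal_ideals_def by blast
  then have "\<top> \<in> ?J"
    using top_closed by metis
  then obtain c where c: "c \<in> M" "\<top> \<sqsubseteq> d \<squnion> c"
    by blast
  then have "d \<squnion> c \<in> carrier L"
    using MD(3) d(1) by auto
  then have "d \<squnion> c = \<top>"
    using c(2) by (intro le_antisym) auto
  then show thesis
    using that c(1) by blast
qed

text \<open>If \<open>y\<close> is outside \<open>M\<close>, take \<open>c\<close> in
  \<open>M\<close> with \<open>y \<squnion> c = \<top>\<close>. Distributivity splits
  \<open>x\<close> into \<open>x \<sqinter> y\<close> and \<open>x \<sqinter> c\<close>, both of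
  which lie in \<open>M\<close>.\<close>

lemma maximal_ideals_prime: "maximal_ideals L \<subseteq> prime_ideals L"
proof
  fix M assume M: "M \<in> maximal_ideals L"
  note MD = maximal_idealD[OF M]
  have "x \<in> M" if xy: "x \<in> carrier L" "y \<in> carrier L" "x \<sqinter> y \<in> M" "y \<notin> M" for x y
  proof -
    obtain c where c: "c \<in> M" "y \<squnion> c = \<top>" "c \<in> carrier L"
      using maximal_ideal_witness[OF M xy(2,4)] MD(3) by blast
    have "x \<sqinter> c \<in> M"
      using MD(7)[OF c(1), of "x \<sqinter> c"] xy c meet_right by simp
    moreover have "x = (x \<sqinter> y) \<squnion> (x \<sqinter> c)"
      using xy c distrib[of x y c] le_iff_join[of x \<top>] by simp
    ultimately show ?thesis
      using MD(6) xy(3) by metis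
  qed
  then show "M \<in> prime_ideals L"
    using MD(1,2) unfolding prime_ideals_def by blast
qed

text \<open>Zorn's lemma for the ideals that contain \<open>I\<close> and omit the top. A union of a
  nonempty chain of such ideals is again one, any two elements lying in a common member of the
  chain.\<close>

lemma ex_maximal_ideal:
  assumes I: "lattice_ideal L I" "I \<noteq> carrier L"
  obtains M where "M \<in> maximal_ideals L" "I \<subseteq> M"
proof -
  let ?A = "{J. lattice_ideal L J \<and> \<top> \<notin> J \<and> I \<subseteq> J}"
  have top: "J \<noteq> carrier L \<longleftrightarrow> \<top> \<notin> J" if "lattice_ideal L J" for J
    by (rule lattice_ideal_top[OF bounded_lattice_axioms that])
  have "\<exists>M\<in>?A. \<forall>X\<in>?A. M \<subseteq> X \<longrightarrow> X = M"
  proof (rule subset_Zorn_nonempty)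
    have "I \<in> ?A"
      using I top[OF I(1)] by simp
    then show "?A \<noteq> {}"
      by (metis empty_iff)
    fix \<C> assume ne: "\<C> \<noteq> {}" and ch: "subset.chain ?A \<C>"
    have mem: "lattice_ideal L J" "\<top> \<notin> J" "I \<subseteq> J" if "J \<in> \<C>" for J
    proof -
      have "J \<in> ?A"
        using ch that unfolding subset_chain_def by (meson subsetD)
      then show "lattice_ideal L J" "\<top> \<notin> J" "I \<subseteq> J"
        by simp_all
    qed
    have J: "J \<subseteq> carrier L" "\<bottom> \<in> J" "\<And>x y. x \<in> J \<Longrightarrow> y \<in> J \<Longrightarrow> x \<squnion> y \<in> J"
      "\<And>x y. x \<in> J \<Longrightarrow> y \<in> carrier L \<Longrightarrow> y \<sqsubseteq> x \<Longrightarrow> y \<in> J" if "J \<in> \<C>" for J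
      using mem(1)[OF that] by (simp_all add: lattice_ideal_def)
    have "x \<squnion> y \<in> \<Union>\<C>" if xy: "x \<in> \<Union>\<C>" "y \<in> \<Union>\<C>" for x y
    proof -
      obtain J K where JK: "J \<in> \<C>" "x \<in> J" "K \<in> \<C>" "y \<in> K"
        using xy by (meson UnionE)
      have "J \<subseteq> K \<or> K \<subseteq> J"
        using ch JK(1,3) unfolding subset_chain_def by metis
      then have "x \<squnion> y \<in> J \<or> x \<squnion> y \<in> K"
        using J(3)[OF JK(1)] J(3)[OF JK(3)] JK(2,4) by (meson subsetD)
      then show ?thesis
        using JK(1,3) by (meson UnionI)
    qed
    moreover have "\<Union>\<C> \<subseteq> carrier L"
      using J(1) by (rule Union_least)
    \<comment> \<open>Any member of the chain supplies the bottom element; this uses that the chain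
      is nonempty.\<close>
    moreover have "\<bottom> \<in> \<Union>\<C>"
      using ne J(2) by (meson UnionI ex_in_conv)
    moreover have "y \<in> \<Union>\<C>" if "x \<in> \<Union>\<C>" "y \<in> carrier L" "y \<sqsubseteq> x" for x y
      using that J(4) by (meson UnionE UnionI)
    ultimately have "lattice_ideal L (\<Union>\<C>)"
      unfolding lattice_ideal_def by (intro conjI ballI impI)
    moreover have "\<top> \<notin> \<Union>\<C>"
      using mem(2) by (meson UnionE)
    moreover have "I \<subseteq> \<Union>\<C>"
      using mem(3) ne by (meson Union_upper ex_in_conv subset_trans)
    ultimately show "\<Union>\<C> \<in> ?A"
      by simp
  qed
  then obtain M where "M \<in> ?A" and max: "\<forall>X\<in>?A. M \<subseteq> X \<longrightarrow> X = M" ..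
  then have M: "lattice_ideal L M" "\<top> \<notin> M" "I \<subseteq> M"
    by simp_all
  have "X = M" if X: "lattice_ideal L X" "X \<noteq> carrier L" "M \<subseteq> X" for X
  proof -
    have "X \<in> ?A"
      using X M(3) top[OF X(1)] by simp
    then show ?thesis
      using max X(3) by simp
  qed
  then have "M \<in> maximal_ideals L"
    using M(1,2) top[OF M(1)] by (simp add: maximal_ideals_def)
  then show thesis
    using that M(3) by metis
qed

text \<open>Conjunctivity, read contrapositively, gives \<open>c\<close> whose join with
  \<open>a\<close> is the top while its join with \<open>b\<close> is not. The principal ideal of
  \<open>b \<squnion> c\<close> is then proper, and a maximal ideal above it contains
  \<open>b\<close> and \<open>c\<close>; it cannot contain \<open>a\<close>, or it would contain the
  top.\<close>

lemma conjunctive_separation: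
  assumes "conjunctive L" and ab: "a \<in> carrier L" "b \<in> carrier L" "\<not> a \<sqsubseteq> b"
  obtains M where "M \<in> maximal_ideals L" "a \<notin> M" "b \<in> M"
proof -
  obtain c where c: "c \<in> carrier L" "a \<squnion> c = \<top>" "b \<squnion> c \<noteq> \<top>"
    using assms unfolding conjunctive_def by blast
  let ?I = "{x \<in> carrier L. x \<sqsubseteq> b \<squnion> c}"
  have bc: "b \<squnion> c \<in> carrier L"
    using ab c by simp
  have "lattice_ideal L ?I"
    using bc by (auto simp: lattice_ideal_def intro: join_le le_trans)
  moreover have "\<top> \<notin> ?I"
    using bc c(3) le_antisym[OF _ top_higher[OF bc]] by auto
  ultimately obtain M where M: "M \<in> maximal_ideals L" "?I \<subseteq> M"
    using ex_maximal_ideal[of ?I] top_closed by blast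
  have "b \<in> M" "c \<in> M"
    using M(2) ab c join_left[of b c] join_right[of b c] by auto
  moreover have "a \<notin> M"
    using maximal_idealD(5,6)[OF M(1)] c(2) \<open>c \<in> M\<close> by metis
  ultimately show thesis
    using that M(1) by blast
qed

section \<open>Basic open sets and the topology of the maximal spectrum\<close>

lemma mem_basic_Max: "d \<in> carrier L \<Longrightarrow> M \<in> basic_Max L d \<longleftrightarrow> M \<in> maximal_ideals L \<and> d \<notin> M"
  by (simp add: basic_Max_def)

lemma basic_Max_top: "basic_Max L \<top> = maximal_ideals L"
  using maximal_idealD(5) by (auto simp: basic_Max_def)

lemma basic_Max_bottom: "basic_Max L \<bottom> = {}"
  using maximal_idealD(4) by (auto simp: basic_Max_def)

lemma basic_Max_join:
  assumes "x \<in> carrier L" "y \<in> carrier L"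
  shows "basic_Max L (x \<squnion> y) = basic_Max L x \<union> basic_Max L y"
proof -
  have "x \<squnion> y \<in> M \<longleftrightarrow> x \<in> M \<and> y \<in> M" if "M \<in> maximal_ideals L" for M
    using maximal_idealD(6,7)[OF that] assms join_left join_right join_closed by metis
  then show ?thesis
    using assms by (auto simp: basic_Max_def)
qed

text \<open>One inclusion is primeness of maximal ideals, the other is downward closure.\<close>

lemma basic_Max_meet:
  assumes "x \<in> carrier L" "y \<in> carrier L"
  shows "basic_Max L (x \<sqinter> y) = basic_Max L x \<inter> basic_Max L y"
proof -
  have "x \<sqinter> y \<in> M \<longleftrightarrow> x \<in> M \<or> y \<in> M" if M: "M \<in> maximal_ideals L" for M
  proof
    show "x \<in> M \<or> y \<in> M" if "x \<sqinter> y \<in> M"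
      using that M maximal_ideals_prime assms by (auto simp: prime_ideals_def)
    show "x \<sqinter> y \<in> M" if "x \<in> M \<or> y \<in> M"
      using that maximal_idealD(7)[OF M] assms meet_left meet_right meet_closed by metis
  qed
  then show ?thesis
    using assms by (auto simp: basic_Max_def)
qed

text \<open>A subtopology only keeps points of the ambient space. Maximal ideals are such points:
  they are prime and omit the top, so they lie in the subbasic set of the top.\<close>

lemma topspace_Max_spec: "topspace (Max_spec L) = maximal_ideals L"
proof -
  have "M \<in> topspace (Spec L)" if M: "M \<in> maximal_ideals L" for M
    using M maximal_idealD(5)[OF M] maximal_ideals_prime top_closed
    unfolding Spec_def topology_generated_by_topspace by blast
  then show ?thesis
    by (auto simp: Max_spec_def)
qed

lemma openin_Max_spec_basic:
  assumes "d \<in> carrier L"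
  shows "openin (Max_spec L) (basic_Max L d)"
proof -
  have "openin (Spec L) {P \<in> prime_ideals L. d \<notin> P}"
    unfolding Spec_def using assms by (intro topology_generated_by_Basis) blast
  moreover have "basic_Max L d = {P \<in> prime_ideals L. d \<notin> P} \<inter> maximal_ideals L"
    using assms maximal_ideals_prime by (auto simp: basic_Max_def)
  ultimately show ?thesis
    by (auto simp: Max_spec_def openin_subtopology)
qed

text \<open>\<open>Spec\<close> is presented by a subbase. The traces of its members on the maximal
  ideals are closed under binary intersection by \<open>basic_Max_meet\<close>, so induction over
  the generated topology finds a single basic set around each maximal ideal of an open set.\<close>

lemma openin_Max_spec:
  "openin (Max_spec L) = arbitrary union_of (\<lambda>U. U \<in> basic_Max L ` carrier L)"
proof
  fix S
  have *: "\<exists>d\<in>carrier L. M \<in> basic_Max L d \<and> basic_Max L d \<subseteq> T"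
    if "generate_topology_on {{P \<in> prime_ideals L. d \<notin> P} |d. d \<in> carrier L} T"
      and "M \<in> T" "M \<in> maximal_ideals L" for T M
    using that
  proof (induction arbitrary: M)
    case (Int a b)
    obtain d e where "d \<in> carrier L" "M \<in> basic_Max L d" "basic_Max L d \<subseteq> a"
      "e \<in> carrier L" "M \<in> basic_Max L e" "basic_Max L e \<subseteq> b"
      using Int.IH[of M] Int.prems by blast
    then show ?case
      by (intro bexI[of _ "d \<sqinter> e"]) (auto simp: basic_Max_meet)
  next
    case (UN K)
    then show ?case by (meson Union_upper UnionE subset_trans)
  next
    case (Basis s)
    then obtain d where "d \<in> carrier L" "s = {P \<in> prime_ideals L. d \<notin> P}" by blast
    then show ?case
      using Basis.prems maximal_ideals_prime
      by (intro bexI[of _ d]) (auto simp: basic_Max_def)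
  qed simp
  show "openin (Max_spec L) S = (arbitrary union_of (\<lambda>U. U \<in> basic_Max L ` carrier L)) S"
  proof
    assume "openin (Max_spec L) S"
    then obtain T where T: "generate_topology_on {{P \<in> prime_ideals L. d \<notin> P} |d. d \<in> carrier L} T"
      "S = T \<inter> maximal_ideals L"
      by (auto simp: Max_spec_def Spec_def openin_subtopology openin_topology_generated_by_iff)
    have "\<exists>U. U \<in> basic_Max L ` carrier L \<and> M \<in> U \<and> U \<subseteq> S" if "M \<in> S" for M
    proof -
      obtain d where d: "d \<in> carrier L" "M \<in> basic_Max L d" "basic_Max L d \<subseteq> T"
        using *[OF T(1), of M] \<open>M \<in> S\<close> T(2) by blast
      moreover have "basic_Max L d \<subseteq> maximal_ideals L"
        using d(1) by (auto simp: basic_Max_def)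
      ultimately show ?thesis
        using T(2) by blast
    qed
    then show "(arbitrary union_of (\<lambda>U. U \<in> basic_Max L ` carrier L)) S"
      by (simp add: arbitrary_union_of_alt)
  next
    assume "(arbitrary union_of (\<lambda>U. U \<in> basic_Max L ` carrier L)) S"
    then have "\<forall>x\<in>S. \<exists>U. openin (Max_spec L) U \<and> x \<in> U \<and> U \<subseteq> S"
      unfolding arbitrary_union_of_alt using openin_Max_spec_basic by blast
    then show "openin (Max_spec L) S"
      by (subst openin_subopen) blast
  qed
qed

lemma open_sublattice_basic_Max: "open_sublattice (Max_spec L) (basic_Max L ` carrier L)"
  unfolding open_sublattice_def topspace_Max_spec
proof (intro conjI ballI)
  show "{} \<in> basic_Max L ` carrier L" "maximal_ideals L \<in> basic_Max L ` carrier L"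
    using basic_Max_bottom basic_Max_top bottom_closed top_closed by blast+
  fix U V assume "U \<in> basic_Max L ` carrier L" "V \<in> basic_Max L ` carrier L"
  then obtain x y where "x \<in> carrier L" "y \<in> carrier L" "U = basic_Max L x" "V = basic_Max L y"
    by blast
  then show "U \<union> V \<in> basic_Max L ` carrier L" "U \<inter> V \<in> basic_Max L ` carrier L"
    using basic_Max_join[of x y] basic_Max_meet[of x y] by (metis imageI join_closed meet_closed)+
qed (use openin_Max_spec_basic in blast)

text \<open>For \<open>M\<close> in the basic set of \<open>d\<close>, take \<open>c\<close> from
  \<open>maximal_ideal_witness\<close>: since \<open>d \<squnion> c\<close> is the top, the basic
  sets of \<open>d\<close> and \<open>c\<close> cover the space, and \<open>c\<close> in
  \<open>M\<close> keeps \<open>M\<close> out of the second.\<close>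

lemma Wallman_base_basic_Max: "Wallman_base (Max_spec L) (basic_Max L ` carrier L)"
proof -
  have "\<exists>V\<in>basic_Max L ` carrier L. U \<union> V = topspace (Max_spec L) \<and> M \<notin> V"
    if U: "U \<in> basic_Max L ` carrier L" "M \<in> U" for U M
  proof -
    obtain d where d: "d \<in> carrier L" "U = basic_Max L d" "M \<in> maximal_ideals L" "d \<notin> M"
      using U mem_basic_Max by blast
    obtain c where c: "c \<in> M" "d \<squnion> c = \<top>" "c \<in> carrier L"
      using maximal_ideal_witness[OF d(3,1,4)] maximal_idealD(3)[OF d(3)] by blast
    have "U \<union> basic_Max L c = maximal_ideals L"
      using basic_Max_join[OF d(1) c(3)] c(2) d(2) basic_Max_top by simp
    moreover have "M \<notin> basic_Max L c"
      using c by (simp add: mem_basic_Max)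
    ultimately show ?thesis
      using c(3) topspace_Max_spec by blast
  qed
  then show ?thesis
    using open_sublattice_basic_Max openin_Max_spec by (simp add: Wallman_base_def)
qed

text \<open>Distinct maximal ideals are incomparable, so some \<open>d\<close> lies in
  \<open>M\<close> but not in \<open>N\<close>; its basic set contains \<open>N\<close> and misses
  \<open>M\<close>.\<close>

lemma t0_space_Max_spec: "t0_space (Max_spec L)"
  unfolding t0_space_def topspace_Max_spec
proof (intro ballI impI)
  fix M N assume MN: "M \<in> maximal_ideals L" "N \<in> maximal_ideals L" "M \<noteq> N"
  then have "\<not> M \<subseteq> N"
    using maximal_ideals_eqI by metis
  then obtain d where d: "d \<in> M" "d \<notin> N" "d \<in> carrier L"
    using maximal_idealD(3)[OF MN(1)] by blast
  then have "M \<notin> basic_Max L d \<longleftrightarrow> N \<in> basic_Max L d"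
    using MN by (simp add: mem_basic_Max)
  then show "\<exists>U. openin (Max_spec L) U \<and> (M \<notin> U) = (N \<in> U)"
    using openin_Max_spec_basic[OF d(3)] by metis
qed

end

lemma bounded_distrib_lattice_iff: "bounded_distrib_lattice L \<longleftrightarrow> bounded_distributive_lattice L"
  by (auto simp: bounded_distrib_lattice_def bounded_distrib_lattice_axioms_def
      bounded_distributive_lattice_def)

lemma DLatW_ObD:
  assumes "L \<in> DLatW_Ob"
  shows "bounded_distrib_lattice L" "bounded_lattice L" "conjunctive L"
  using assms by (auto simp: DLatW_Ob_def bounded_distrib_lattice_iff bounded_distributive_lattice_def)


section \<open>Lattices of open sets\<close>

lemma carrier_set_lattice [simp]: "carrier (set_lattice D) = D"
  by (simp add: set_lattice_def)

lemma le_set_lattice [simp]: "U \<sqsubseteq>\<^bsub>set_lattice D\<^esub> V \<longleftrightarrow> U \<subseteq> V"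
  by (simp add: set_lattice_def)

lemma partial_order_set_lattice: "partial_order (set_lattice D)"
  by standard (auto simp: set_lattice_def)

context
  fixes X :: "'a topology" and D
  assumes D: "open_sublattice X D"
begin

text \<open>A \<open>gorder\<close> carries no operations: joins, meets and bounds are determined by
  the order. They are identified with the set operations by exhibiting these as extremal bounds and
  appealing to uniqueness.\<close>

lemma least_Upper_set_lattice:
  assumes "U \<in> D" "V \<in> D"
  shows "least (set_lattice D) (U \<union> V) (Upper (set_lattice D) {U, V})"
  using assms D by (auto simp: least_def Upper_def open_sublattice_def)

lemma greatest_Lower_set_lattice:
  assumes "U \<in> D" "V \<in> D"
  shows "greatest (set_lattice D) (U \<inter> V) (Lower (set_lattice D) {U, V})"
  using assms D by (auto simp: greatest_def Lower_def open_sublattice_def)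

lemma least_set_lattice: "least (set_lattice D) {} D"
  using D by (auto simp: least_def open_sublattice_def)

lemma greatest_set_lattice: "greatest (set_lattice D) (topspace X) D"
  using D openin_subset by (fastforce simp: greatest_def open_sublattice_def)

lemma bounded_lattice_set_lattice: "bounded_lattice (set_lattice D)"
proof -
  interpret partial_order "set_lattice D"
    by (rule partial_order_set_lattice)
  show ?thesis
    by unfold_locales
      (use least_Upper_set_lattice greatest_Lower_set_lattice least_set_lattice
        greatest_set_lattice in \<open>simp_all, metis+\<close>)
qed

interpretation bounded_lattice "set_lattice D"
  by (rule bounded_lattice_set_lattice)

lemma join_set_lattice:
  assumes "U \<in> D" "V \<in> D"
  shows "U \<squnion>\<^bsub>set_lattice D\<^esub> V = U \<union> V"
  by (rule joinI) (simp_all add: assms least_unique[OF _ least_Upper_set_lattice[OF assms]])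

lemma meet_set_lattice:
  assumes "U \<in> D" "V \<in> D"
  shows "U \<sqinter>\<^bsub>set_lattice D\<^esub> V = U \<inter> V"
  by (rule meetI) (simp_all add: assms greatest_unique[OF _ greatest_Lower_set_lattice[OF assms]])

lemma bottom_set_lattice: "\<bottom>\<^bsub>set_lattice D\<^esub> = {}"
  by (rule least_unique[OF bottom_least]) (simp add: least_set_lattice)

lemma top_set_lattice: "\<top>\<^bsub>set_lattice D\<^esub> = topspace X"
  by (rule greatest_unique[OF top_greatest]) (simp add: greatest_set_lattice)

lemma bounded_distrib_lattice_set_lattice: "bounded_distrib_lattice (set_lattice D)"
proof
  fix U V W assume "U \<in> carrier (set_lattice D)" "V \<in> carrier (set_lattice D)"
    "W \<in> carrier (set_lattice D)"
  \<comment> \<open>Membership of the inner sets in \<open>D\<close> lets the rewriting of joins and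
    meets reach the outer operations.\<close>
  moreover from this have "V \<union> W \<in> D" "U \<inter> V \<in> D" "U \<inter> W \<in> D"
    using D by (auto simp: open_sublattice_def)
  ultimately show "U \<sqinter>\<^bsub>set_lattice D\<^esub> (V \<squnion>\<^bsub>set_lattice D\<^esub> W) =
      (U \<sqinter>\<^bsub>set_lattice D\<^esub> V) \<squnion>\<^bsub>set_lattice D\<^esub> (U \<sqinter>\<^bsub>set_lattice D\<^esub> W)"
    by (simp add: join_set_lattice meet_set_lattice Int_Un_distrib)
qed

end

text \<open>For \<open>x\<close> in \<open>U\<close>, the Wallman condition gives \<open>W\<close>
  that covers the space together with \<open>U\<close> but misses \<open>x\<close>. By hypothesis
  \<open>V\<close> and \<open>W\<close> also cover, so \<open>x\<close> must lie in
  \<open>V\<close>.\<close>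

lemma conjunctive_set_lattice:
  assumes "Wallman_base X B"
  shows "conjunctive (set_lattice B)"
  unfolding conjunctive_def
proof (intro ballI impI)
  have B: "open_sublattice X B"
    using assms by (simp add: Wallman_base_def)
  note [simp] = join_set_lattice[OF B] top_set_lattice[OF B]
  fix U V assume UV: "U \<in> carrier (set_lattice B)" "V \<in> carrier (set_lattice B)"
    and *: "\<forall>W\<in>carrier (set_lattice B). U \<squnion>\<^bsub>set_lattice B\<^esub> W = \<top>\<^bsub>set_lattice B\<^esub>
      \<longrightarrow> V \<squnion>\<^bsub>set_lattice B\<^esub> W = \<top>\<^bsub>set_lattice B\<^esub>"
  have "x \<in> V" if x: "x \<in> U" for x
  proof -
    obtain W where W: "W \<in> B" "U \<union> W = topspace X" "x \<notin> W"
      using assms UV x unfolding Wallman_base_def carrier_set_lattice by blast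
    then have "V \<union> W = topspace X"
      using * UV by auto
    then show ?thesis
      using W x by blast
  qed
  then show "U \<sqsubseteq>\<^bsub>set_lattice B\<^esub> V"
    by auto
qed


section \<open>Spaces with a Wallman base\<close>

lemma TopDLatW_ObD:
  assumes "(X, B) \<in> TopDLatW_Ob"
  shows "t0_space X" "Wallman_base X B" "open_sublattice X B"
    and "eta (X, B) ` topspace X = maximal_ideals (set_lattice B)"
    and "\<And>U. U \<in> B \<Longrightarrow> openin X U" "\<And>U. U \<in> B \<Longrightarrow> U \<subseteq> topspace X"
  using assms openin_subset
  by (auto simp: TopDLatW_Ob_def Wallman_base_def open_sublattice_def)

lemma mem_eta: "x \<in> topspace X \<Longrightarrow> U \<in> eta (X, B) x \<longleftrightarrow> U \<in> B \<and> x \<notin> U"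
  by (simp add: eta_def)

lemma TopDLatW_HomD:
  assumes "f \<in> TopDLatW_Hom (X, B) (Y, B')"
  shows "f \<in> extensional (topspace X)" "continuous_map X Y f"
    and "\<And>x. x \<in> topspace X \<Longrightarrow> f x \<in> topspace Y" "\<And>V. V \<in> B' \<Longrightarrow> preim X f V \<in> B"
  using assms by (auto simp: TopDLatW_Hom_def dest: continuous_map_funspace)

text \<open>The value at \<open>x\<close> records which members of the base miss \<open>x\<close>.
  Points with equal values lie in the same members of the base, hence in the same open sets, and T0
  identifies them.\<close>

lemma inj_on_eta:
  assumes "(X, B) \<in> TopDLatW_Ob"
  shows "inj_on (eta (X, B)) (topspace X)"
proof (rule inj_onI, rule ccontr)
  fix x y assume xy: "x \<in> topspace X" "y \<in> topspace X" "eta (X, B) x = eta (X, B) y" "x \<noteq> y"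
  have *: "x \<in> V \<longleftrightarrow> y \<in> V" if "V \<in> B" for V
    using that xy mem_eta[of x X V B] mem_eta[of y X V B] by auto
  obtain U where U: "openin X U" "x \<notin> U \<longleftrightarrow> y \<in> U"
    using TopDLatW_ObD(1)[OF assms] xy unfolding t0_space_def by blast
  have "\<exists>V\<in>B. z \<in> V \<and> V \<subseteq> U" if "z \<in> U" for z
    using TopDLatW_ObD(2)[OF assms] U(1) that
    by (auto simp: Wallman_base_def arbitrary_union_of_alt)
  then show False
    using U(2) * by blast
qed

section \<open>The functor H: preimages of members of the base\<close>

lemma H_ob_DLatW_Ob: "A \<in> TopDLatW_Ob \<Longrightarrow> H_ob A \<in> DLatW_Ob"
  using bounded_distrib_lattice_set_lattice conjunctive_set_lattice TopDLatW_ObD(2,3)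
  by (cases A) (fastforce simp: H_ob_def DLatW_Ob_def bounded_distrib_lattice_iff[symmetric])

text \<open>The preimage of \<open>V\<close> misses \<open>x\<close> exactly when \<open>V\<close>
  misses \<open>f x\<close>. The identity serves twice: for maximality of preimage maps and for
  naturality of \<open>eta\<close>.\<close>

lemma Spec_map_H_arr_eta:
  assumes "f \<in> TopDLatW_Hom (X, B) (Y, B')" "x \<in> topspace X"
  shows "Spec_map (set_lattice B') (H_arr (X, B) (Y, B') f) (eta (X, B) x) = eta (Y, B') (f x)"
  using TopDLatW_HomD[OF assms(1)] assms(2)
  by (auto simp: Spec_map_def H_arr_def mem_eta preim_def)

lemma H_arr_DLatW_Hom:
  assumes "A \<in> TopDLatW_Ob" "A' \<in> TopDLatW_Ob" "f \<in> TopDLatW_Hom A A'"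
  shows "H_arr A A' f \<in> DLatW_Hom (H_ob A') (H_ob A)"
proof -
  obtain X B Y B' where A: "A = (X, B)" "A' = (Y, B')"
    by (metis surj_pair)
  note X = TopDLatW_ObD[OF assms(1)[unfolded A]] and Y = TopDLatW_ObD[OF assms(2)[unfolded A]]
  note f = TopDLatW_HomD[OF assms(3)[unfolded A]]
  have [simp]: "{} \<in> B'" "topspace Y \<in> B'"
    "\<And>U V. U \<in> B' \<Longrightarrow> V \<in> B' \<Longrightarrow> U \<union> V \<in> B'" "\<And>U V. U \<in> B' \<Longrightarrow> V \<in> B' \<Longrightarrow> U \<inter> V \<in> B'"
    using Y(3) by (auto simp: open_sublattice_def)
  have preim: "preim X f {} = {}" "preim X f (topspace Y) = topspace X"
    "preim X f (U \<union> V) = preim X f U \<union> preim X f V"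
    "preim X f (U \<inter> V) = preim X f U \<inter> preim X f V" for U V
    using f(3) by (auto simp: preim_def)
  have "H_arr A A' f \<in> lattice_hom (H_ob A') (H_ob A)"
    using f(4)
    by (auto simp: A H_ob_def H_arr_def lattice_hom_def preim
        bottom_set_lattice[OF X(3)] bottom_set_lattice[OF Y(3)]
        top_set_lattice[OF X(3)] top_set_lattice[OF Y(3)]
        join_set_lattice[OF X(3)] join_set_lattice[OF Y(3)]
        meet_set_lattice[OF X(3)] meet_set_lattice[OF Y(3)])
  moreover have "Spec_map (H_ob A') (H_arr A A' f) M \<in> maximal_ideals (H_ob A')"
    if M: "M \<in> maximal_ideals (H_ob A)" for M
  proof -
    \<comment> \<open>Surjectivity of \<open>eta\<close> onto the maximal ideals turns
      \<open>M\<close> into a point; its pullback is \<open>eta\<close> at \<open>f x\<close>, which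
      is maximal because \<open>A'\<close> is an object too.\<close>
    obtain x where x: "x \<in> topspace X" "M = eta (X, B) x"
      using M X(4) by (auto simp: A H_ob_def)
    show ?thesis
      using Spec_map_H_arr_eta[OF assms(3)[unfolded A] x(1)] Y(4) f(3)[OF x(1)]
      by (auto simp: A H_ob_def x(2))
  qed
  ultimately show ?thesis
    by (auto simp: DLatW_Hom_def)
qed

lemma H_arr_id:
  assumes "A \<in> TopDLatW_Ob"
  shows "H_arr A A (TopDLatW_id A) = DLatW_id (H_ob A)"
proof -
  obtain X B where A: "A = (X, B)"
    by fastforce
  show ?thesis
    \<comment> \<open>Preimage under the identity intersects with the space, which leaves members of
      the base unchanged.\<close>
    using TopDLatW_ObD(6)[OF assms[unfolded A]]
    by (fastforce simp: A H_arr_def TopDLatW_id_def DLatW_id_def H_ob_def preim_def fun_eq_iff)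
qed

lemma H_arr_comp:
  assumes "f \<in> TopDLatW_Hom A A'" "g \<in> TopDLatW_Hom A' A''"
  shows "H_arr A A'' (TopDLatW_comp A g f) = DLatW_comp (H_ob A'') (H_arr A A' f) (H_arr A' A'' g)"
proof -
  obtain X B Y B' Z B'' where A: "A = (X, B)" "A' = (Y, B')" "A'' = (Z, B'')"
    by (metis surj_pair)
  show ?thesis
    using TopDLatW_HomD[OF assms(1)[unfolded A]] TopDLatW_HomD[OF assms(2)[unfolded A]]
    by (auto simp: A H_arr_def TopDLatW_comp_def DLatW_comp_def H_ob_def preim_def compose_def
        fun_eq_iff)
qed


section \<open>The space of maximal ideals\<close>

text \<open>Inverse of the isomorphism \<open>basic_Max\<close> onto its image, for conjunctive
  distributive \<open>L\<close>. It is cut down to that image to be extensional.\<close>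

definition basic_Max_inv :: "'a gorder \<Rightarrow> 'a set set \<Rightarrow> 'a" where
  "basic_Max_inv L = restrict (inv_into (carrier L) (basic_Max L)) (basic_Max L ` carrier L)"

context
  fixes L :: "'a gorder"
  assumes L: "L \<in> DLatW_Ob"
begin

interpretation bounded_distrib_lattice L
  by (rule DLatW_ObD(1)[OF L])

section \<open>A conjunctive lattice as the lattice of its basic open sets\<close>

lemma basic_Max_lattice_hom: "basic_Max L \<in> lattice_hom L (set_lattice (basic_Max L ` carrier L))"
proof -
  note B = open_sublattice_basic_Max
  show ?thesis
    by (auto simp: lattice_hom_def bottom_set_lattice[OF B] top_set_lattice[OF B]
        join_set_lattice[OF B] meet_set_lattice[OF B] basic_Max_bottom basic_Max_top
        basic_Max_join basic_Max_meet topspace_Max_spec)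
      (simp_all add: basic_Max_def)
qed

text \<open>Elements with the same basic set lie in the same maximal ideals, so
  \<open>conjunctive_separation\<close>, applied in both directions, makes each lie below the
  other.\<close>

lemma inj_on_basic_Max: "inj_on (basic_Max L) (carrier L)"
proof (rule inj_onI)
  fix a b assume ab: "a \<in> carrier L" "b \<in> carrier L" "basic_Max L a = basic_Max L b"
  have "a \<in> M \<longleftrightarrow> b \<in> M" if "M \<in> maximal_ideals L" for M
    using ab that mem_basic_Max by metis
  then have "a \<sqsubseteq>\<^bsub>L\<^esub> b" "b \<sqsubseteq>\<^bsub>L\<^esub> a"
    using conjunctive_separation[OF DLatW_ObD(3)[OF L]] ab by metis+
  then show "a = b"
    using ab le_antisym by blast
qed

lemma basic_Max_inv_lattice_hom:
  "basic_Max_inv L \<in> lattice_hom (set_lattice (basic_Max L ` carrier L)) L"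
  using lattice_hom_inverse[OF bounded_lattice_axioms basic_Max_lattice_hom inj_on_basic_Max]
  by (simp add: basic_Max_inv_def)

lemma basic_Max_inv_basic_Max: "d \<in> carrier L \<Longrightarrow> basic_Max_inv L (basic_Max L d) = d"
  using inj_on_basic_Max by (simp add: basic_Max_inv_def)

lemma basic_Max_basic_Max_inv:
  "U \<in> basic_Max L ` carrier L \<Longrightarrow> basic_Max L (basic_Max_inv L U) = U"
  by (simp add: basic_Max_inv_def f_inv_into_f)

lemma Spec_map_basic_Max:
  "M \<in> maximal_ideals (set_lattice (basic_Max L ` carrier L))
    \<Longrightarrow> Spec_map L (basic_Max L) M \<in> maximal_ideals L"
  using Spec_map_iso_maximal[OF bounded_lattice_axioms
      bounded_lattice_set_lattice[OF open_sublattice_basic_Max]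
      basic_Max_lattice_hom basic_Max_inv_lattice_hom]
    basic_Max_inv_basic_Max basic_Max_basic_Max_inv by auto

lemma Spec_map_basic_Max_inv:
  "M \<in> maximal_ideals L
    \<Longrightarrow> Spec_map (set_lattice (basic_Max L ` carrier L)) (basic_Max_inv L) M
      \<in> maximal_ideals (set_lattice (basic_Max L ` carrier L))"
  using Spec_map_iso_maximal[OF bounded_lattice_set_lattice[OF open_sublattice_basic_Max]
      bounded_lattice_axioms basic_Max_inv_lattice_hom basic_Max_lattice_hom]
    basic_Max_inv_basic_Max basic_Max_basic_Max_inv by auto

lemma basic_Max_iso: "basic_Max L \<in> DLatW_iso L (H_ob (K_ob L))"
proof -
  have "basic_Max L \<in> DLatW_Hom L (H_ob (K_ob L))"
    using basic_Max_lattice_hom Spec_map_basic_Max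
    by (auto simp: DLatW_Hom_def H_ob_def K_ob_def)
  moreover have "basic_Max_inv L \<in> DLatW_Hom (H_ob (K_ob L)) L"
    using basic_Max_inv_lattice_hom Spec_map_basic_Max_inv
    by (auto simp: DLatW_Hom_def H_ob_def K_ob_def)
  moreover have "DLatW_comp L (basic_Max_inv L) (basic_Max L) = DLatW_id L"
    using basic_Max_inv_basic_Max by (auto simp: DLatW_comp_def DLatW_id_def compose_def fun_eq_iff)
  moreover have "DLatW_comp (H_ob (K_ob L)) (basic_Max L) (basic_Max_inv L)
      = DLatW_id (H_ob (K_ob L))"
    using basic_Max_basic_Max_inv
    by (auto simp: DLatW_comp_def DLatW_id_def compose_def fun_eq_iff H_ob_def K_ob_def)
  ultimately show ?thesis
    unfolding DLatW_iso_def by blast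
qed

text \<open>The basic set of \<open>d\<close> misses \<open>M\<close> exactly when \<open>d\<close>
  lies in \<open>M\<close>. Thus \<open>eta\<close> at \<open>K_ob L\<close> merely transports
  ideals of \<open>L\<close> to its isomorphic copy.\<close>

lemma eta_K_ob:
  assumes "M \<in> maximal_ideals L"
  shows "eta (K_ob L) M = Spec_map (set_lattice (basic_Max L ` carrier L)) (basic_Max_inv L) M"
  using assms basic_Max_inv_basic_Max
  by (auto simp: eta_def K_ob_def topspace_Max_spec Spec_map_def mem_basic_Max)

lemma eta_image_K_ob:
  "eta (K_ob L) ` maximal_ideals L = maximal_ideals (set_lattice (basic_Max L ` carrier L))"
proof
  show "eta (K_ob L) ` maximal_ideals L \<subseteq> maximal_ideals (set_lattice (basic_Max L ` carrier L))"
    using eta_K_ob Spec_map_basic_Max_inv by auto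
  show "maximal_ideals (set_lattice (basic_Max L ` carrier L)) \<subseteq> eta (K_ob L) ` maximal_ideals L"
  proof
    fix N assume N: "N \<in> maximal_ideals (set_lattice (basic_Max L ` carrier L))"
    then have "N \<subseteq> basic_Max L ` carrier L"
      by (simp add: maximal_ideals_def lattice_ideal_def)
    \<comment> \<open>The preimage of \<open>N\<close> under \<open>eta\<close> is its pullback
      along \<open>basic_Max\<close>, since pulling back along \<open>basic_Max_inv\<close> reverses
      this.\<close>
    then have "N = Spec_map (set_lattice (basic_Max L ` carrier L)) (basic_Max_inv L)
        (Spec_map L (basic_Max L) N)"
      using Spec_map_inverse[OF basic_Max_inv_lattice_hom, of "basic_Max L" N]
        basic_Max_basic_Max_inv by simp
    then have "N = eta (K_ob L) (Spec_map L (basic_Max L) N)"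
      using eta_K_ob Spec_map_basic_Max[OF N] by simp
    then show "N \<in> eta (K_ob L) ` maximal_ideals L"
      using Spec_map_basic_Max[OF N] by blast
  qed
qed

lemma K_ob_TopDLatW_Ob: "K_ob L \<in> TopDLatW_Ob"
  using t0_space_Max_spec Wallman_base_basic_Max eta_image_K_ob topspace_Max_spec
  by (simp add: TopDLatW_Ob_def K_ob_def)

lemma topspace_K_ob: "topspace (fst (K_ob L)) = maximal_ideals L"
  by (simp add: K_ob_def topspace_Max_spec)

lemma K_arr_id: "K_arr L L (DLatW_id L) = TopDLatW_id (K_ob L)"
  using maximal_idealD(3)
  by (auto simp: K_arr_def TopDLatW_id_def topspace_K_ob Spec_map_def DLatW_id_def fun_eq_iff)

end

section \<open>The functor K on arrows, and naturality of \<open>basic_Max\<close>\<close>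

lemma DLatW_HomD:
  assumes "f \<in> DLatW_Hom L L'"
  shows "f \<in> lattice_hom L L'" "f \<in> extensional (carrier L)"
    and "\<And>x. x \<in> carrier L \<Longrightarrow> f x \<in> carrier L'"
    and "\<And>M. M \<in> maximal_ideals L' \<Longrightarrow> Spec_map L f M \<in> maximal_ideals L"
  using assms by (auto simp: DLatW_Hom_def lattice_hom_def PiE_iff)

text \<open>By definition \<open>d\<close> lies in the pullback of \<open>M\<close> iff
  \<open>f d\<close> lies in \<open>M\<close>. This computation yields continuity of
  \<open>K_arr\<close>, its compatibility with the bases and naturality of
  \<open>basic_Max\<close>.\<close>

lemma preim_K_arr_basic_Max:
  assumes "L' \<in> DLatW_Ob" "f \<in> DLatW_Hom L L'" "d \<in> carrier L"
  shows "preim (Max_spec L') (K_arr L L' f) (basic_Max L d) = basic_Max L' (f d)"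
proof -
  interpret bounded_distrib_lattice L'
    by (rule DLatW_ObD(1)[OF assms(1)])
  show ?thesis
    using DLatW_HomD[OF assms(2)] assms(3)
    by (auto simp: preim_def topspace_Max_spec K_arr_def basic_Max_def Spec_map_def)
qed

text \<open>Each point of the preimage of an open set has the preimage of a base member as a
  neighbourhood inside it. The criterion is applied to \<open>K_arr\<close>, to \<open>eta\<close>
  and to the inverse of \<open>eta\<close>.\<close>

lemma continuous_map_into_base:
  assumes "f \<in> topspace X \<rightarrow> topspace Y" "openin Y = arbitrary union_of (\<lambda>U. U \<in> B)"
    and "\<And>U. U \<in> B \<Longrightarrow> openin X (preim X f U)"
  shows "continuous_map X Y f"
proof -
  have "openin X {x \<in> topspace X. f x \<in> U}" if U: "openin Y U" for U
  proof (subst openin_subopen, intro ballI)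
    fix x assume x: "x \<in> {x \<in> topspace X. f x \<in> U}"
    then obtain V where "V \<in> B" "f x \<in> V" "V \<subseteq> U"
      using x U unfolding assms(2) arbitrary_union_of_alt by blast
    then show "\<exists>T. openin X T \<and> x \<in> T \<and> T \<subseteq> {x \<in> topspace X. f x \<in> U}"
      using x assms(3)[of V] by (intro exI[of _ "preim X f V"]) (auto simp: preim_def)
  qed
  then show ?thesis
    using assms(1) by (auto simp: continuous_map_def)
qed

lemma K_arr_TopDLatW_Hom:
  assumes "L \<in> DLatW_Ob" "L' \<in> DLatW_Ob" "f \<in> DLatW_Hom L L'"
  shows "K_arr L L' f \<in> TopDLatW_Hom (K_ob L') (K_ob L)"
proof -
  interpret L: bounded_distrib_lattice L
    by (rule DLatW_ObD(1)[OF assms(1)])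
  interpret L': bounded_distrib_lattice L'
    by (rule DLatW_ObD(1)[OF assms(2)])
  note f = DLatW_HomD[OF assms(3)]
  have pre: "preim (Max_spec L') (K_arr L L' f) U \<in> basic_Max L' ` carrier L'"
    if "U \<in> basic_Max L ` carrier L" for U
    using that preim_K_arr_basic_Max[OF assms(2,3)] f(3) by auto
  have "continuous_map (Max_spec L') (Max_spec L) (K_arr L L' f)"
  proof (rule continuous_map_into_base[OF _ L.openin_Max_spec])
    show "K_arr L L' f \<in> topspace (Max_spec L') \<rightarrow> topspace (Max_spec L)"
      using f(4) by (auto simp: L.topspace_Max_spec L'.topspace_Max_spec K_arr_def)
    show "openin (Max_spec L') (preim (Max_spec L') (K_arr L L' f) U)"
      if "U \<in> basic_Max L ` carrier L" for U
      using pre[OF that] L'.openin_Max_spec_basic by auto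
  qed
  then show ?thesis
    using pre by (auto simp: TopDLatW_Hom_def K_ob_def L'.topspace_Max_spec K_arr_def)
qed

lemma K_arr_comp:
  assumes "L'' \<in> DLatW_Ob" "f \<in> DLatW_Hom L L'" "g \<in> DLatW_Hom L' L''"
  shows "K_arr L L'' (DLatW_comp L g f) = TopDLatW_comp (K_ob L'') (K_arr L L' f) (K_arr L' L'' g)"
  using DLatW_HomD[OF assms(2)] DLatW_HomD[OF assms(3)]
  by (auto simp: K_arr_def TopDLatW_comp_def topspace_K_ob[OF assms(1)] Spec_map_def DLatW_comp_def
      compose_def fun_eq_iff)

lemma basic_Max_natural:
  assumes "L \<in> DLatW_Ob" "L' \<in> DLatW_Ob" "f \<in> DLatW_Hom L L'"
  shows "DLatW_comp L (H_arr (K_ob L') (K_ob L) (K_arr L L' f)) (basic_Max L)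
    = DLatW_comp L (basic_Max L') f"
  using preim_K_arr_basic_Max[OF assms(2,3)]
  by (auto simp: DLatW_comp_def compose_def H_arr_def K_ob_def fun_eq_iff)


section \<open>Naturality and invertibility of the unit\<close>

lemma eta_natural:
  assumes "A \<in> TopDLatW_Ob" "A' \<in> TopDLatW_Ob" "f \<in> TopDLatW_Hom A A'"
  shows "TopDLatW_comp A (K_arr (H_ob A') (H_ob A) (H_arr A A' f)) (eta A)
    = TopDLatW_comp A (eta A') f"
proof -
  obtain X B Y B' where A: "A = (X, B)" "A' = (Y, B')"
    by (metis surj_pair)
  \<comment> \<open>\<open>K_arr\<close> is specified on maximal ideals only, so \<open>eta\<close>
    must be known to land there before the two composites can be compared pointwise.\<close>
  have "eta (X, B) x \<in> maximal_ideals (set_lattice B)" if "x \<in> topspace X" for x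
    using TopDLatW_ObD(4)[OF assms(1)[unfolded A]] that by blast
  then show ?thesis
    using Spec_map_H_arr_eta[OF assms(3)[unfolded A]]
    by (auto simp: A H_ob_def K_arr_def TopDLatW_comp_def compose_def fun_eq_iff)
qed

text \<open>T0 and the condition on the image make \<open>eta\<close> a bijection onto the maximal
  ideals. It matches each \<open>U\<close> in \<open>B\<close> with the basic set of
  \<open>U\<close>, so both it and its inverse pull base members back to base members, which gives
  continuity and the arrow conditions in both directions.\<close>

lemma eta_iso:
  assumes "A \<in> TopDLatW_Ob"
  shows "eta A \<in> TopDLatW_iso A (K_ob (H_ob A))"
proof -
  obtain X B where A: "A = (X, B)"
    by fastforce
  note X = TopDLatW_ObD[OF assms[unfolded A]]
  let ?L = "set_lattice B" and ?e = "eta (X, B)"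
  interpret bounded_distrib_lattice ?L
    by (rule bounded_distrib_lattice_set_lattice[OF X(3)])
  define g where "g = restrict (inv_into (topspace X) ?e) (maximal_ideals ?L)"
  have ge: "g (?e x) = x" if "x \<in> topspace X" for x
    using that X(4) inj_on_eta[OF assms[unfolded A]] by (auto simp: g_def)
  have eg: "?e (g M) = M" "g M \<in> topspace X" if "M \<in> maximal_ideals ?L" for M
    using that X(4) f_inv_into_f[of M ?e] inv_into_into[of M ?e] by (auto simp: g_def)
  have e: "?e x \<in> maximal_ideals ?L" if "x \<in> topspace X" for x
    using that X(4) by blast
  have pre_e: "preim X ?e (basic_Max ?L U) = U" if "U \<in> B" for U
    using that e X(6)[OF that] by (auto simp: preim_def mem_basic_Max mem_eta)
  \<comment> \<open>A maximal ideal \<open>M\<close> equals \<open>eta (X, B) (g M)\<close>, so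
    \<open>U\<close> is outside \<open>M\<close> iff \<open>g M\<close> lies in
    \<open>U\<close>.\<close>
  have pre_g: "preim (Max_spec ?L) g U = basic_Max ?L U" if "U \<in> B" for U
    using that eg mem_eta[of "g _" X U B]
    by (auto simp: preim_def mem_basic_Max topspace_Max_spec) metis+
  have K: "K_ob (H_ob A) = (Max_spec ?L, basic_Max ?L ` B)"
    by (simp add: A K_ob_def H_ob_def)
  have "continuous_map X (Max_spec ?L) ?e"
    by (rule continuous_map_into_base[OF _ openin_Max_spec])
      (use e X(5) pre_e in \<open>auto simp: topspace_Max_spec\<close>)
  then have "eta A \<in> TopDLatW_Hom A (K_ob (H_ob A))"
    unfolding K using pre_e by (auto simp: A TopDLatW_Hom_def eta_def)
  moreover have "continuous_map (Max_spec ?L) X g"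
  proof (rule continuous_map_into_base)
    show "openin X = arbitrary union_of (\<lambda>U. U \<in> B)"
      using X(2) by (simp add: Wallman_base_def)
  qed (use eg pre_g openin_Max_spec_basic in \<open>auto simp: topspace_Max_spec\<close>)
  then have "g \<in> TopDLatW_Hom (K_ob (H_ob A)) A"
    unfolding K using pre_g by (auto simp: A TopDLatW_Hom_def topspace_Max_spec g_def)
  moreover have "TopDLatW_comp A g (eta A) = TopDLatW_id A"
    using ge by (auto simp: A TopDLatW_comp_def TopDLatW_id_def compose_def fun_eq_iff)
  moreover have "TopDLatW_comp (K_ob (H_ob A)) (eta A) g = TopDLatW_id (K_ob (H_ob A))"
    unfolding K using eg
    by (auto simp: A TopDLatW_comp_def TopDLatW_id_def compose_def fun_eq_iff topspace_Max_spec)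
  ultimately show ?thesis
    unfolding TopDLatW_iso_def by blast
qed

(* Clauses 1-4: H is a functor from the opposite of TopDLat_W to DLat_W; clauses 5-8: K is a functor
   from DLat_W to the opposite of TopDLat_W; clauses 9-10: eta is a natural isomorphism from the
   identity to K H; clauses 11-12: basic_Max is a natural isomorphism from the identity to H K. *)
theorem theorem3p1:
  shows
    "(\<forall>A :: 'a topdlat. A \<in> TopDLatW_Ob \<longrightarrow> H_ob A \<in> DLatW_Ob) \<and>
     (\<forall>(A :: 'a topdlat) (A' :: 'b topdlat) f.
        A \<in> TopDLatW_Ob \<and> A' \<in> TopDLatW_Ob \<and> f \<in> TopDLatW_Hom A A'
        \<longrightarrow> H_arr A A' f \<in> DLatW_Hom (H_ob A') (H_ob A)) \<and>
     (\<forall>A :: 'a topdlat. A \<in> TopDLatW_Ob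
        \<longrightarrow> H_arr A A (TopDLatW_id A) = DLatW_id (H_ob A)) \<and>
     (\<forall>(A :: 'a topdlat) (A' :: 'b topdlat) (A'' :: 'c topdlat) f g.
        A \<in> TopDLatW_Ob \<and> A' \<in> TopDLatW_Ob \<and> A'' \<in> TopDLatW_Ob \<and>
        f \<in> TopDLatW_Hom A A' \<and> g \<in> TopDLatW_Hom A' A''
        \<longrightarrow> H_arr A A'' (TopDLatW_comp A g f)
            = DLatW_comp (H_ob A'') (H_arr A A' f) (H_arr A' A'' g)) \<and>
     (\<forall>L :: 'a gorder. L \<in> DLatW_Ob \<longrightarrow> K_ob L \<in> TopDLatW_Ob) \<and>
     (\<forall>(L :: 'a gorder) (L' :: 'b gorder) f.
        L \<in> DLatW_Ob \<and> L' \<in> DLatW_Ob \<and> f \<in> DLatW_Hom L L'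
        \<longrightarrow> K_arr L L' f \<in> TopDLatW_Hom (K_ob L') (K_ob L)) \<and>
     (\<forall>L :: 'a gorder. L \<in> DLatW_Ob
        \<longrightarrow> K_arr L L (DLatW_id L) = TopDLatW_id (K_ob L)) \<and>
     (\<forall>(L :: 'a gorder) (L' :: 'b gorder) (L'' :: 'c gorder) f g.
        L \<in> DLatW_Ob \<and> L' \<in> DLatW_Ob \<and> L'' \<in> DLatW_Ob \<and>
        f \<in> DLatW_Hom L L' \<and> g \<in> DLatW_Hom L' L''
        \<longrightarrow> K_arr L L'' (DLatW_comp L g f)
            = TopDLatW_comp (K_ob L'') (K_arr L L' f) (K_arr L' L'' g)) \<and>
     (\<forall>A :: 'a topdlat. A \<in> TopDLatW_Ob \<longrightarrow> eta A \<in> TopDLatW_iso A (K_ob (H_ob A))) \<and>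
     (\<forall>(A :: 'a topdlat) (A' :: 'b topdlat) f.
        A \<in> TopDLatW_Ob \<and> A' \<in> TopDLatW_Ob \<and> f \<in> TopDLatW_Hom A A'
        \<longrightarrow> TopDLatW_comp A (K_arr (H_ob A') (H_ob A) (H_arr A A' f)) (eta A)
            = TopDLatW_comp A (eta A') f) \<and>
     (\<forall>L :: 'a gorder. L \<in> DLatW_Ob \<longrightarrow> basic_Max L \<in> DLatW_iso L (H_ob (K_ob L))) \<and>
     (\<forall>(L :: 'a gorder) (L' :: 'b gorder) f.
        L \<in> DLatW_Ob \<and> L' \<in> DLatW_Ob \<and> f \<in> DLatW_Hom L L'
        \<longrightarrow> DLatW_comp L (H_arr (K_ob L') (K_ob L) (K_arr L L' f)) (basic_Max L)
            = DLatW_comp L (basic_Max L') f)"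
  by (intro conjI allI impI)
    (auto intro: H_ob_DLatW_Ob H_arr_DLatW_Hom H_arr_id H_arr_comp
      K_ob_TopDLatW_Ob K_arr_TopDLatW_Hom K_arr_id K_arr_comp
      eta_iso eta_natural basic_Max_iso basic_Max_natural)

end
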